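(* Let $\alpha>-1$, $\beta>0$ and let $n$ be a positive integer with $n>\beta$. Define the infinite matrix $P=(P_{k,j})_{k,j\ge 0}$ by $$P_{k,j}=\frac{(n-\beta)^{k+\alpha+1}n^j}{\Gamma(k+\alpha+1)\,j!}\,\frac{\Gamma(j+k+\alpha+1)}{(2n-\beta)^{j+k+\alpha+1}}=\Big(\frac{n-\beta}{2n-\beta}\Big)^{k+\alpha+1}\Big(\frac{n}{2n-\beta}\Big)^j\frac{(k+\alpha+1)_j}{j!}.$$ Then $P$ is nonnegative and row-stochastic (each row sums to $1$), and the operator $M_n^{(\alpha,\beta)}$ and $P$ are related as follows: if $v=(v_j)_{j\ge 0}$ is any coefficient vector for which the Poisson series $$\Phi_v(x):=\sum_{j\ge 0}v_j\,\psi_{n,j}(x)$$ converges, then $$M_n^{(\alpha,\beta)}[\Phi_v]=\Phi_{Pv}.$$ Consequently the following eigenpairs hold for $M_n^{(\alpha,\beta)}$: (1) $\lambda_1=1$ is an eigenvalue with eigenfunction $\phi_1(x)\equiv 1$; (2) $\lambda_2=\big(1-\tfrac{\beta}{n}\big)^{\alpha+1}$ is an eigenvalue with eigenfunction $\phi_2(x)=e^{-\beta x}$. More precisely, the vectors $v^{(1)}=(1,1,1,\dots)$ and $v^{(2)}=\big((1-\tfrac{\beta}{n})^j\big)_{j\ge 0}$ satisfy $Pv^{(1)}=v^{(1)}$ and $Pv^{(2)}=\lambda_2v^{(2)}$, and lifting these vectors via $v\mapsto\Phi_v$ yields the stated eigenfunctions: $\Phi_{v^{(1)}}=\phi_1$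 and $\Phi_{v^{(2)}}=\phi_2$.
   Context: For $k=0,1,2,\dots$ and $x\ge 0$ put $\psi_{n,k}(x)=\dfrac{(nx)^k e^{-nx}}{k!}$. The operator $M_n^{(\alpha,\beta)}$ is $$M_n^{(\alpha,\beta)}[f](x)=\sum_{k=0}^{\infty}\left(\frac{(n-\beta)^{k+\alpha+1}}{\Gamma(k+\alpha+1)}\int_0^\infty f(t)\,t^{k+\alpha}e^{-(n-\beta)t}\,dt\right)\psi_{n,k}(x),\qquad x\ge 0.$$ $(a)_j=a(a+1)\cdots(a+j-1)$, $(a)_0=1$, is the rising factorial, and $(Pv)_k=\sum_{j\ge 0}P_{k,j}v_j$.
   Formalization: The identity M[Φ_v] = Φ_{Pv} is stated for v such that every series (Pv)_k converges (it fails to for v_j = (-R)^j, R large), and says that at each x ≥ 0 one side is defined exactly when the other is, with equal values. *)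

theory Defs
  imports "HOL-Analysis.Analysis"
begin

definition psi :: "nat \<Rightarrow> nat \<Rightarrow> real \<Rightarrow> real" where
  "psi n k x = (real n * x) ^ k * exp (- real n * x) / fact k"

definition Phi_converges :: "nat \<Rightarrow> (nat \<Rightarrow> real) \<Rightarrow> real \<Rightarrow> bool" where
  "Phi_converges n v x \<longleftrightarrow> summable (\<lambda>j. v j * psi n j x)"

definition Phi :: "nat \<Rightarrow> (nat \<Rightarrow> real) \<Rightarrow> real \<Rightarrow> real" where
  "Phi n v x = (\<Sum>j. v j * psi n j x)"

definition M_integrand :: "real \<Rightarrow> real \<Rightarrow> nat \<Rightarrow> (real \<Rightarrow> real) \<Rightarrow> nat \<Rightarrow> real \<Rightarrow> real" where
  "M_integrand \<alpha> \<beta> n f k t = f t * t powr (real k + \<alpha>) * exp (- (real n - \<beta>) * t)"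

definition M_coeff :: "real \<Rightarrow> real \<Rightarrow> nat \<Rightarrow> (real \<Rightarrow> real) \<Rightarrow> nat \<Rightarrow> real" where
  "M_coeff \<alpha> \<beta> n f k =
     (real n - \<beta>) powr (real k + \<alpha> + 1) / Gamma (real k + \<alpha> + 1) *
     (LBINT t:{0<..}. M_integrand \<alpha> \<beta> n f k t)"

(* The operator is only meaningful where all its integrals exist (as Lebesgue integrals) and its
   series converges; since the Isabelle operators are total, this is a separate predicate. *)

definition M_defined :: "real \<Rightarrow> real \<Rightarrow> nat \<Rightarrow> (real \<Rightarrow> real) \<Rightarrow> real \<Rightarrow> bool" where
  "M_defined \<alpha> \<beta> n f x \<longleftrightarrow>
     (\<forall>k. set_integrable lborel {0<..} (M_integrand \<alpha> \<beta> n f k)) \<and>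
     summable (\<lambda>k. M_coeff \<alpha> \<beta> n f k * psi n k x)"

definition M :: "real \<Rightarrow> real \<Rightarrow> nat \<Rightarrow> (real \<Rightarrow> real) \<Rightarrow> real \<Rightarrow> real" where
  "M \<alpha> \<beta> n f x = (\<Sum>k. M_coeff \<alpha> \<beta> n f k * psi n k x)"

(* Functions are regarded as functions on [0, \<infinity>); values at negative arguments are irrelevant. *)

definition M_eigenpair :: "real \<Rightarrow> real \<Rightarrow> nat \<Rightarrow> real \<Rightarrow> (real \<Rightarrow> real) \<Rightarrow> bool" where
  "M_eigenpair \<alpha> \<beta> n l \<phi> \<longleftrightarrow>
     (\<exists>x\<ge>0. \<phi> x \<noteq> 0) \<and>
     (\<forall>x\<ge>0. M_defined \<alpha> \<beta> n \<phi> x \<and> M \<alpha> \<beta> n \<phi> x = l * \<phi> x)"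

definition P :: "real \<Rightarrow> real \<Rightarrow> nat \<Rightarrow> nat \<Rightarrow> nat \<Rightarrow> real" where
  "P \<alpha> \<beta> n k j =
     ((real n - \<beta>) powr (real k + \<alpha> + 1) * real n ^ j) / (Gamma (real k + \<alpha> + 1) * fact j) *
     (Gamma (real j + real k + \<alpha> + 1) / (2 * real n - \<beta>) powr (real j + real k + \<alpha> + 1))"

definition P_apply_defined :: "real \<Rightarrow> real \<Rightarrow> nat \<Rightarrow> (nat \<Rightarrow> real) \<Rightarrow> bool" where
  "P_apply_defined \<alpha> \<beta> n v \<longleftrightarrow> (\<forall>k. summable (\<lambda>j. P \<alpha> \<beta> n k j * v j))"

definition P_apply :: "real \<Rightarrow> real \<Rightarrow> nat \<Rightarrow> (nat \<Rightarrow> real) \<Rightarrow> nat \<Rightarrow> real" where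
  "P_apply \<alpha> \<beta> n v k = (\<Sum>j. P \<alpha> \<beta> n k j * v j)"

end

theory Submission
  imports Defs
begin

text \<open>Inserting a Poisson series into the operator and integrating term by term, each integral is a
  Gamma integral and produces exactly the entry \<open>P\<^sub>k\<^sub>,\<^sub>j\<close>. The interchange needs
  \<open>\<Sum>\<^sub>j P\<^sub>k\<^sub>,\<^sub>j \<bar>v\<^sub>j\<bar> < \<infinity>\<close>, although only plain convergence of the rows is given: since
  \<open>P\<^sub>k\<^sub>+\<^sub>2\<^sub>,\<^sub>j / P\<^sub>k\<^sub>,\<^sub>j\<close> grows quadratically in \<open>j\<close>, boundedness of the terms in row \<open>k + 2\<close> gives absolute
  convergence of row \<open>k\<close>. Row sums and the eigenvector identity are instances of the binomial
  series.\<close>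

section \<open>The Gamma integral, the binomial series and the Poisson weights\<close>

lemma has_bochner_integral_Gamma_scaled:
  fixes s b :: real
  assumes "s > 0" "b > 0"
  shows "has_bochner_integral lborel
           (\<lambda>t. indicator {0<..} t * (t powr (s - 1) * exp (- b * t))) (Gamma s / b powr s)"
proof -
  have "has_bochner_integral lborel (\<lambda>t. indicator {0..} t * t powr (s - 1) / exp t) (Gamma s)"
    using assms
    by (intro has_bochner_integral_nn_integral)
       (auto simp: Gamma_conv_nn_integral_real[symmetric] intro!: AE_I2 Gamma_real_nonneg)
  then have "has_bochner_integral lborel
      (\<lambda>t. indicator {0..} (0 + b * t) * (0 + b * t) powr (s - 1) / exp (0 + b * t))
      (Gamma s /\<^sub>R \<bar>b\<bar>)"
    using assms by (subst (asm) lborel_has_bochner_integral_real_affine_iff[where c = b and t = 0]) auto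
  \<comment> \<open>The factor \<open>b powr (1 - s)\<close> cancels the power of \<open>b\<close>
    inside \<open>(b * t) powr (s - 1)\<close>; together with the Jacobian 1/b of the substitution
    it leaves \<open>b powr - s\<close> on the right.\<close>
  then have "has_bochner_integral lborel
      (\<lambda>t. b powr (1 - s) *
        (indicator {0..} (0 + b * t) * (0 + b * t) powr (s - 1) / exp (0 + b * t)))
      (b powr (1 - s) * (Gamma s /\<^sub>R \<bar>b\<bar>))"
    by (rule has_bochner_integral_mult_right)
  also have "(\<lambda>t. b powr (1 - s) *
        (indicator {0..} (0 + b * t) * (0 + b * t) powr (s - 1) / exp (0 + b * t))) =
      (\<lambda>t. indicator {0<..} t * (t powr (s - 1) * exp (- b * t)))"
  proof
    fix t :: real
    have "b powr (1 - s) * b powr (s - 1) = 1"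
      using assms by (simp flip: powr_add)
    then show "b powr (1 - s) *
        (indicator {0..} (0 + b * t) * (0 + b * t) powr (s - 1) / exp (0 + b * t)) =
      indicator {0<..} t * (t powr (s - 1) * exp (- b * t))"
      \<comment> \<open>Passing from \<open>{0..}\<close> to \<open>{0<..}\<close> is harmless even
        pointwise, since \<open>0 powr (s - 1) = 0\<close>.\<close>
      using assms
      by (cases "t > 0"; cases "t = 0")
         (auto simp: indicator_def powr_mult exp_minus zero_le_mult_iff field_simps)
  qed
  also have "b powr (1 - s) * (Gamma s /\<^sub>R \<bar>b\<bar>) = Gamma s / b powr s"
    using assms by (simp add: powr_diff field_simps)
  finally show ?thesis .
qed

text \<open>This is the binomial series with exponent -c: the sign in (-c choose j) = (-1)^j (c)_j /
  j! cancels against that of (-z)^j.\<close>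

lemma pochhammer_powser_sums:
  fixes c z :: real
  assumes "\<bar>z\<bar> < 1"
  shows "(\<lambda>j. z ^ j * (pochhammer c j / fact j)) sums (1 - z) powr - c"
proof -
  have "(\<lambda>j. (- c gchoose j) * (- z) ^ j) sums (1 + - z) powr - c"
    using assms by (intro gen_binomial_real) auto
  moreover have "(- c gchoose j) * (- z) ^ j = z ^ j * (pochhammer c j / fact j)" for j
  proof -
    have "(- 1 :: real) ^ j * (- z) ^ j = z ^ j"
      by (simp flip: power_mult_distrib)
    then show ?thesis
      by (simp add: gbinomial_pochhammer mult_ac)
  qed
  ultimately show ?thesis by simp
qed

lemma psi_nonneg: "x \<ge> 0 \<Longrightarrow> psi n j x \<ge> 0"
  by (simp add: psi_def)

text \<open>The exponential series at q n x. Taking q = 1 and q = 1 - \<beta>/n will produce the two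
  eigenfunctions.\<close>

lemma psi_powers_sums: "(\<lambda>j. q ^ j * psi n j x) sums exp (- (1 - q) * real n * x)"
proof -
  have "(\<lambda>j. exp (- real n * x) * ((q * (real n * x)) ^ j /\<^sub>R fact j))
          sums (exp (- real n * x) * exp (q * (real n * x)))"
    by (intro sums_mult exp_converges)
  also have "(\<lambda>j. exp (- real n * x) * ((q * (real n * x)) ^ j /\<^sub>R fact j)) =
      (\<lambda>j. q ^ j * psi n j x)"
    by (simp add: psi_def power_mult_distrib divide_inverse mult_ac)
  also have "exp (- real n * x) * exp (q * (real n * x)) = exp (- (1 - q) * real n * x)"
    by (simp add: algebra_simps flip: exp_add)
  finally show ?thesis .
qed

text \<open>Up to the factor exp (-n x), the Poisson series is a power series in n x with
  coefficients v_j / j!. Convergence at the larger point x + 1 therefore forces absolute convergence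
  at x.\<close>

lemma Phi_converges_abs:
  assumes "n > 0" "\<forall>x\<ge>0. Phi_converges n v x" "x \<ge> 0"
  shows "summable (\<lambda>j. \<bar>v j * psi n j x\<bar>)"
proof -
  have "summable (\<lambda>j. v j * psi n j (x + 1))"
    using assms by (simp add: Phi_converges_def)
  then have "summable (\<lambda>j. exp (real n * (x + 1)) * (v j * psi n j (x + 1)))"
    by (rule summable_mult)
  moreover have "exp y * (v j * (y ^ j * exp (- y) / fact j)) = v j / fact j * y ^ j" for y j
    by (simp add: exp_minus)
  then have "exp (real n * (x + 1)) * (v j * psi n j (x + 1)) =
      v j / fact j * (real n * (x + 1)) ^ j" for j
    by (simp only: psi_def mult_minus_left)
  ultimately have "summable (\<lambda>j. v j / fact j * (real n * (x + 1)) ^ j)"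
    by simp
  then have "summable (\<lambda>j. norm (v j / fact j * (real n * x) ^ j))"
    using assms by (rule_tac powser_insidea) (auto simp: abs_mult)
  then have "summable (\<lambda>j. exp (- real n * x) * norm (v j / fact j * (real n * x) ^ j))"
    by (rule summable_mult)
  also have "(\<lambda>j. exp (- real n * x) * norm (v j / fact j * (real n * x) ^ j)) =
      (\<lambda>j. \<bar>v j * psi n j x\<bar>)"
    using assms by (simp add: psi_def abs_mult mult_ac)
  finally show ?thesis .
qed

section \<open>Row sums, eigenvectors and absolute convergence for the matrix
  \<open>P\<close>\<close>

context
  fixes \<alpha> \<beta> :: real and n :: nat
  assumes \<alpha>: "\<alpha> > -1" and \<beta>: "\<beta> > 0" and n: "real n > \<beta>"
begin

text \<open>With c = k + \<alpha> + 1 > 0, which is no pole of Gamma, the quotient Gamma (c + j) /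
  Gamma c is the rising factorial, and the power of 2n - \<beta> splits into exponents c and
  j.\<close>

lemma P_eq:
  "P \<alpha> \<beta> n k j =
     ((real n - \<beta>) / (2 * real n - \<beta>)) powr (real k + \<alpha> + 1) *
     (real n / (2 * real n - \<beta>)) ^ j * (pochhammer (real k + \<alpha> + 1) j / fact j)"
proof -
  define c where "c = real k + \<alpha> + 1"
  have c: "c > 0" using \<alpha> by (simp add: c_def)
  have "c \<notin> \<int>\<^sub>\<le>\<^sub>0" using c by (auto elim!: nonpos_Ints_cases)
  moreover have "Gamma c > 0" using c by (rule Gamma_real_pos)
  ultimately have "Gamma (c + real j) = pochhammer c j * Gamma c"
    by (simp add: pochhammer_Gamma)
  moreover have "(2 * real n - \<beta>) powr (c + real j) = (2 * real n - \<beta>) powr c * (2 * real n - \<beta>) ^ j"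
    using n \<beta> by (simp add: powr_add powr_realpow)
  moreover have "((real n - \<beta>) / (2 * real n - \<beta>)) powr c =
      (real n - \<beta>) powr c / (2 * real n - \<beta>) powr c"
    using n \<beta> by (simp add: powr_divide)
  moreover have arg: "real j + real k + \<alpha> + 1 = c + real j" by (simp add: c_def)
  ultimately show ?thesis
    using \<open>Gamma c > 0\<close> unfolding P_def arg c_def[symmetric] by (simp add: power_divide mult_ac)
qed

lemma P_nonneg: "P \<alpha> \<beta> n k j \<ge> 0"
  using \<alpha> \<beta> n unfolding P_eq
  by (intro mult_nonneg_nonneg divide_nonneg_nonneg pochhammer_nonneg zero_le_power) auto

text \<open>The generating function of row k: a binomial series in z = n q / (2n - \<beta>), where
  the bound on q says exactly that \<bar>z\<bar> < 1. Row sums and the second eigenvector are the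
  cases q = 1 and q = 1 - \<beta>/n.\<close>

lemma P_powers_sums:
  assumes "\<bar>q\<bar> < 2 - \<beta> / real n"
  shows "(\<lambda>j. P \<alpha> \<beta> n k j * q ^ j) sums
           ((real n - \<beta>) / (2 * real n - \<beta> - q * real n)) powr (real k + \<alpha> + 1)"
proof -
  define c where "c = real k + \<alpha> + 1"
  define d where "d = 2 * real n - \<beta>"
  define z where "z = real n / d * q"
  have d: "d > 0" using n \<beta> by (simp add: d_def)
  have n0: "real n > 0" using n \<beta> by simp
  have "real n * \<bar>q\<bar> < d"
    using mult_strict_left_mono[OF assms n0] n0 by (simp add: d_def right_diff_distrib)
  then have z: "\<bar>z\<bar> < 1"
    using d n0 by (simp add: z_def abs_mult)
  have "(\<lambda>j. ((real n - \<beta>) / d) powr c * (z ^ j * (pochhammer c j / fact j))) sums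
      (((real n - \<beta>) / d) powr c * (1 - z) powr - c)"
    by (intro sums_mult pochhammer_powser_sums z)
  also have "(\<lambda>j. ((real n - \<beta>) / d) powr c * (z ^ j * (pochhammer c j / fact j))) =
      (\<lambda>j. P \<alpha> \<beta> n k j * q ^ j)"
    unfolding P_eq c_def[symmetric] d_def[symmetric] z_def power_mult_distrib by (simp add: mult_ac)
  also have "((real n - \<beta>) / d) powr c * (1 - z) powr - c = ((real n - \<beta>) / d / (1 - z)) powr c"
    using n d z by (simp add: powr_divide powr_minus_divide powr_mult)
  also have "(real n - \<beta>) / d / (1 - z) = (real n - \<beta>) / (d - q * real n)"
    using d by (simp add: z_def right_diff_distrib mult.commute)
  finally show ?thesis by (simp add: c_def d_def)
qed

lemma P_row_sums: "(\<lambda>j. P \<alpha> \<beta> n k j) sums 1"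
  using P_powers_sums[of 1 k] \<beta> n by (simp add: field_simps)

text \<open>The number q = 1 - \<beta>/n is a fixed point of q -> (n - \<beta>) / (2n - \<beta> - q
  n), the base in the generating function. Row k thus sums to q^(k + \<alpha> + 1), which splits
  into the eigenvalue q^(\<alpha> + 1) and the entry q^k.\<close>

lemma P_eigenvector_sums:
  "(\<lambda>j. P \<alpha> \<beta> n k j * (1 - \<beta> / real n) ^ j) sums
     ((1 - \<beta> / real n) powr (\<alpha> + 1) * (1 - \<beta> / real n) ^ k)"
proof -
  define q where "q = 1 - \<beta> / real n"
  have q: "q > 0" "\<bar>q\<bar> < 2 - \<beta> / real n" using n \<beta> by (auto simp: q_def)
  have "2 * real n - \<beta> - q * real n = real n" "(real n - \<beta>) / real n = q"
    using n \<beta> by (auto simp: q_def field_simps)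
  moreover have "q powr (real k + \<alpha> + 1) = q powr (\<alpha> + 1) * q ^ k"
    using q(1) by (simp add: powr_add powr_realpow mult_ac)
  ultimately show ?thesis
    using P_powers_sums[OF q(2), of k] by (simp only: flip: q_def)
qed

text \<open>Since c (c + 1)_j = (c + j) (c)_j, moving down one row multiplies the entry by a factor
  linear in j.\<close>

lemma P_Suc:
  "P \<alpha> \<beta> n (Suc k) j =
     P \<alpha> \<beta> n k j * ((real n - \<beta>) / (2 * real n - \<beta>) * (real k + \<alpha> + 1 + real j) / (real k + \<alpha> + 1))"
proof -
  define c where "c = real k + \<alpha> + 1"
  have c: "c > 0" using \<alpha> by (simp add: c_def)
  have "c * pochhammer (c + 1) j = (c + real j) * pochhammer c j"
    by (metis pochhammer_rec pochhammer_rec')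
  then have "pochhammer (c + 1) j = pochhammer c j * (c + real j) / c"
    using c by (simp add: field_simps)
  moreover have arg: "real (Suc k) + \<alpha> + 1 = c + 1" by (simp add: c_def)
  ultimately show ?thesis
    using n \<beta> unfolding P_eq arg c_def[symmetric] by (simp add: powr_add mult_ac)
qed

text \<open>Comparison with row k + 2 rather than k + 1: one linear factor would only give a bound
  of order 1/j, whereas two give the summable 1/j^2.\<close>

lemma P_abs_summable:
  assumes "P_apply_defined \<alpha> \<beta> n v"
  shows "summable (\<lambda>j. P \<alpha> \<beta> n k j * \<bar>v j\<bar>)"
proof -
  define c where "c = real k + \<alpha> + 1"
  define p where "p = (real n - \<beta>) / (2 * real n - \<beta>)"
  have c: "c > 0" using \<alpha> by (simp add: c_def)
  have p: "p > 0" using n \<beta> by (simp add: p_def)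
  have "(\<lambda>j. P \<alpha> \<beta> n (Suc (Suc k)) j * v j) \<longlonglongrightarrow> 0"
    using assms by (intro summable_LIMSEQ_zero) (simp add: P_apply_defined_def)
  then obtain B where B: "\<And>j. \<bar>P \<alpha> \<beta> n (Suc (Suc k)) j * v j\<bar> \<le> B"
    by (metis Bseq_def convergentI convergent_imp_Bseq real_norm_def)
  \<comment> \<open>Two uses of the row recurrence give the ratio p^2 (c + j) (c + 1 + j) / (c (c +
    1)), which is at least p^2 j^2 / (c (c + 1)); \<open>D\<close> is \<open>B\<close> divided by
    the constant part of that bound.\<close>
  define D where "D = B * (c * (c + 1)) / p\<^sup>2"
  \<comment> \<open>The index 0 is left out because the right side is 0 there, by
    \<open>inverse 0 = 0\<close>.\<close>
  have bound: "norm (P \<alpha> \<beta> n k j * \<bar>v j\<bar>) \<le> D * inverse (real j ^ 2)" if "j \<ge> 1" for j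
  proof -
    define X where "X = P \<alpha> \<beta> n k j * \<bar>v j\<bar>"
    have X: "X \<ge> 0" using P_nonneg by (simp add: X_def)
    have "P \<alpha> \<beta> n (Suc (Suc k)) j =
        P \<alpha> \<beta> n k j * (p * (c + real j) / c) * (p * (c + 1 + real j) / (c + 1))"
      unfolding P_Suc by (simp add: p_def c_def add_ac)
    then have "\<bar>P \<alpha> \<beta> n (Suc (Suc k)) j * v j\<bar> =
        X * (p * (c + real j) / c) * (p * (c + 1 + real j) / (c + 1))"
      using c p P_nonneg[of k j] by (simp add: X_def abs_mult)
    also have "\<dots> = X * p\<^sup>2 * ((c + real j) * (c + 1 + real j)) / (c * (c + 1))"
      by (simp add: power2_eq_square)
    finally have "X * p\<^sup>2 * ((c + real j) * (c + 1 + real j)) \<le> B * (c * (c + 1))"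
      using B[of j] c by (simp add: pos_divide_le_eq)
    moreover have "real j * real j \<le> (c + real j) * (c + 1 + real j)"
      using c by (intro mult_mono) auto
    then have "X * p\<^sup>2 * (real j * real j) \<le> X * p\<^sup>2 * ((c + real j) * (c + 1 + real j))"
      using X by (intro mult_left_mono) auto
    ultimately have "X * p\<^sup>2 * (real j * real j) \<le> B * (c * (c + 1))" by linarith
    then have "X \<le> D * inverse (real j ^ 2)"
      using that p by (simp add: D_def field_simps power2_eq_square)
    then show ?thesis using X by (simp add: X_def)
  qed
  have "summable (\<lambda>j. D * inverse (real j ^ 2))"
    by (intro summable_mult inverse_power_summable) auto
  then show ?thesis
    by (rule summable_comparison_test[rotated]) (use bound in blast)
qed

section \<open>The operator applied to Poisson series\<close>

lemma has_bochner_integral_M_integrand_psi: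
  "has_bochner_integral lborel (\<lambda>t. indicator {0<..} t * M_integrand \<alpha> \<beta> n (psi n j) k t)
     (P \<alpha> \<beta> n k j / ((real n - \<beta>) powr (real k + \<alpha> + 1) / Gamma (real k + \<alpha> + 1)))"
proof -
  define c where "c = real k + \<alpha> + 1"
  have c: "c > 0" using \<alpha> by (simp add: c_def)
  have G: "Gamma c > 0" using c by (rule Gamma_real_pos)
  \<comment> \<open>The factor t^j of \<open>psi n j\<close> raises the Gamma parameter from c to c
    + j, and its exponential turns the rate n - \<beta> into 2n - \<beta>.\<close>
  have "has_bochner_integral lborel
      (\<lambda>t. real n ^ j / fact j *
        (indicator {0<..} t * (t powr (c + real j - 1) * exp (- (2 * real n - \<beta>) * t))))
      (real n ^ j / fact j * (Gamma (c + real j) / (2 * real n - \<beta>) powr (c + real j)))"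
    using c n \<beta> by (intro has_bochner_integral_mult_right has_bochner_integral_Gamma_scaled) auto
  also have "(\<lambda>t. real n ^ j / fact j *
        (indicator {0<..} t * (t powr (c + real j - 1) * exp (- (2 * real n - \<beta>) * t)))) =
      (\<lambda>t. indicator {0<..} t * M_integrand \<alpha> \<beta> n (psi n j) k t)"
  proof
    fix t :: real
    have "t powr (c + real j - 1) = t powr (real k + \<alpha>) * t ^ j" if "t > 0"
      using that by (simp add: c_def add_ac flip: powr_realpow powr_add)
    moreover have "exp (- (2 * real n - \<beta>) * t) = exp (- real n * t) * exp (- (real n - \<beta>) * t)"
      by (simp add: algebra_simps flip: exp_add)
    ultimately show "real n ^ j / fact j *
        (indicator {0<..} t * (t powr (c + real j - 1) * exp (- (2 * real n - \<beta>) * t))) =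
      indicator {0<..} t * M_integrand \<alpha> \<beta> n (psi n j) k t"
      by (cases "t > 0") (auto simp: M_integrand_def psi_def power_mult_distrib)
  qed
  also have "real n ^ j / fact j * (Gamma (c + real j) / (2 * real n - \<beta>) powr (c + real j)) =
      P \<alpha> \<beta> n k j / ((real n - \<beta>) powr c / Gamma c)"
    using G n by (simp add: P_def c_def add_ac)
  finally show ?thesis by (simp add: c_def)
qed

text \<open>Sum and integral are interchanged by absolute convergence, both pointwise in t and for
  the integrals of the norms. The j-th integral is then
  \<open>v j * P \<alpha> \<beta> n k j / K\<close>, and the prefactor \<open>K\<close> of
  \<open>M_coeff\<close> cancels.\<close>

lemma M_integrand_Phi:
  assumes conv: "\<forall>x\<ge>0. Phi_converges n v x" and def: "P_apply_defined \<alpha> \<beta> n v"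
  shows set_integrable_M_integrand_Phi:
      "set_integrable lborel {0<..} (M_integrand \<alpha> \<beta> n (Phi n v) k)"
    and M_coeff_Phi: "M_coeff \<alpha> \<beta> n (Phi n v) k = P_apply \<alpha> \<beta> n v k"
proof -
  define c where "c = real k + \<alpha> + 1"
  define K where "K = (real n - \<beta>) powr c / Gamma c"
  have K: "K > 0" using \<alpha> n by (simp add: K_def c_def Gamma_real_pos)
  define g where "g j t = indicator {0<..} t * M_integrand \<alpha> \<beta> n (psi n j) k t" for j t
  define f where "f j t = v j * g j t" for j t
  have g: "has_bochner_integral lborel (g j) (P \<alpha> \<beta> n k j / K)" for j
    using has_bochner_integral_M_integrand_psi[of j k] by (simp add: g_def[abs_def] K_def c_def)
  \<comment> \<open>Nonnegativity makes the norm of \<open>f j\<close> equal to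
    \<open>\<bar>v j\<bar> * g j\<close>, so its integral is known exactly.\<close>
  have g_nonneg: "g j t \<ge> 0" for j t
    by (simp add: g_def M_integrand_def indicator_def psi_nonneg)
  have f: "has_bochner_integral lborel (f j) (v j * (P \<alpha> \<beta> n k j / K))" for j
    unfolding f_def using g by (rule has_bochner_integral_mult_right)
  have "has_bochner_integral lborel (\<lambda>t. norm (f j t)) (\<bar>v j\<bar> * (P \<alpha> \<beta> n k j / K))" for j
    using has_bochner_integral_mult_right[OF g, of "\<bar>v j\<bar>" j] g_nonneg
    by (simp add: f_def abs_mult)
  then have norm_f: "(\<integral>t. norm (f j t) \<partial>lborel) = P \<alpha> \<beta> n k j * \<bar>v j\<bar> / K" for j
    by (simp add: has_bochner_integral_iff)
  have f_eq: "f j t = v j * psi n j t *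
      (indicator {0<..} t * t powr (real k + \<alpha>) * exp (- (real n - \<beta>) * t))" for j t
    by (simp add: f_def g_def M_integrand_def)
  have n0: "n > 0" using n \<beta> by (cases n) auto
  have pointwise: "summable (\<lambda>j. norm (f j t))"
    and lim: "(\<Sum>j. f j t) = indicator {0<..} t * M_integrand \<alpha> \<beta> n (Phi n v) k t" for t
  proof -
    \<comment> \<open>Convergence of the Poisson series is assumed only for nonnegative arguments;
      the indicator inside \<open>w\<close> makes all terms vanish for t \<le> 0.\<close>
    define w where "w = indicator {0<..} t * t powr (real k + \<alpha>) * exp (- (real n - \<beta>) * t)"
    have "summable (\<lambda>j. \<bar>v j * psi n j t\<bar> * \<bar>w\<bar>)" if "t > 0"
      using Phi_converges_abs[OF n0 conv] that by (intro summable_mult2) auto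
    moreover have "(\<lambda>j. norm (f j t)) = (\<lambda>j. \<bar>v j * psi n j t\<bar> * \<bar>w\<bar>)"
      by (simp add: f_eq abs_mult w_def)
    ultimately show "summable (\<lambda>j. norm (f j t))"
      by (cases "t > 0") (auto simp: w_def)
    have "(\<Sum>j. v j * psi n j t * w) = Phi n v t * w" if "t > 0"
      using conv that by (simp add: Phi_def Phi_converges_def suminf_mult2)
    moreover have "w = 0" if "\<not> t > 0" using that by (simp add: w_def)
    ultimately have "(\<Sum>j. v j * psi n j t * w) = Phi n v t * w"
      by (cases "t > 0") auto
    then show "(\<Sum>j. f j t) = indicator {0<..} t * M_integrand \<alpha> \<beta> n (Phi n v) k t"
      by (simp add: f_eq w_def M_integrand_def mult_ac)
  qed
  \<comment> \<open>Here the plain convergence of the rows has to be upgraded to absolute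
    convergence.\<close>
  have summable_norm: "summable (\<lambda>j. \<integral>t. norm (f j t) \<partial>lborel)"
    unfolding norm_f by (intro summable_divide P_abs_summable def)
  have integrable_f: "integrable lborel (f j)" for j
    using f by (auto simp: has_bochner_integral_iff)
  have "integrable lborel (\<lambda>t. \<Sum>j. f j t)"
    by (rule integrable_suminf) (use integrable_f pointwise summable_norm in auto)
  then show "set_integrable lborel {0<..} (M_integrand \<alpha> \<beta> n (Phi n v) k)"
    by (simp add: lim set_integrable_def)
  have "(\<integral>t. (\<Sum>j. f j t) \<partial>lborel) = (\<Sum>j. \<integral>t. f j t \<partial>lborel)"
    by (rule integral_suminf) (use integrable_f pointwise summable_norm in auto)
  also have "\<dots> = (\<Sum>j. P \<alpha> \<beta> n k j * v j / K)"
    using f by (simp add: has_bochner_integral_iff mult_ac)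
  also have "\<dots> = P_apply \<alpha> \<beta> n v k / K"
    using def by (simp add: P_apply_def P_apply_defined_def suminf_divide)
  finally show "M_coeff \<alpha> \<beta> n (Phi n v) k = P_apply \<alpha> \<beta> n v k"
    using K unfolding M_coeff_def set_lebesgue_integral_def c_def[symmetric] K_def[symmetric]
    by (simp add: lim)
qed

text \<open>The two series have the same coefficients, hence converge at the same points; where they
  diverge, both sides are still the same \<open>suminf\<close>.\<close>

lemma M_Phi:
  assumes "\<forall>x\<ge>0. Phi_converges n v x" "P_apply_defined \<alpha> \<beta> n v"
  shows "M_defined \<alpha> \<beta> n (Phi n v) x \<longleftrightarrow> Phi_converges n (P_apply \<alpha> \<beta> n v) x"
    and "M \<alpha> \<beta> n (Phi n v) x = Phi n (P_apply \<alpha> \<beta> n v) x"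
  using set_integrable_M_integrand_Phi[OF assms] M_coeff_Phi[OF assms]
  by (auto simp: M_defined_def M_def Phi_def Phi_converges_def)

text \<open>Lifts an eigenvector of \<open>P\<close> to an eigenfunction: the factor l comes out of
  the Poisson series by linearity. The point x witnesses that the lifted function is not zero on the
  half-line.\<close>

lemma M_eigenpair_Phi:
  assumes conv: "\<forall>x\<ge>0. Phi_converges n v x" and eig: "\<And>k. (\<lambda>j. P \<alpha> \<beta> n k j * v j) sums (l * v k)"
    and "x \<ge> 0" "Phi n v x \<noteq> 0"
  shows "M_eigenpair \<alpha> \<beta> n l (Phi n v)"
proof -
  have def: "P_apply_defined \<alpha> \<beta> n v"
    using eig by (auto simp: P_apply_defined_def sums_iff)
  have "P_apply \<alpha> \<beta> n v = (\<lambda>k. l * v k)"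
    using eig by (auto simp: P_apply_def sums_iff)
  moreover have "(\<lambda>j. l * v j * psi n j y) sums (l * Phi n v y)" if "y \<ge> 0" for y
    using conv that unfolding Phi_def Phi_converges_def mult.assoc
    by (intro sums_mult summable_sums) auto
  ultimately have "Phi_converges n (P_apply \<alpha> \<beta> n v) y \<and> Phi n (P_apply \<alpha> \<beta> n v) y = l * Phi n v y"
    if "y \<ge> 0" for y
    using that by (auto simp: Phi_def Phi_converges_def sums_iff)
  then show ?thesis
    using assms M_Phi[OF conv def] by (auto simp: M_eigenpair_def)
qed

end

theorem theorem7:
  fixes \<alpha> \<beta> :: real and n :: nat
  assumes "\<alpha> > -1" and "\<beta> > 0" and "n > 0" and "real n > \<beta>"
  defines "v1 \<equiv> (\<lambda>j::nat. 1 :: real)"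
    and "v2 \<equiv> (\<lambda>j::nat. (1 - \<beta> / real n) ^ j)"
    and "\<phi>1 \<equiv> (\<lambda>x::real. 1 :: real)"
    and "\<phi>2 \<equiv> (\<lambda>x::real. exp (- \<beta> * x))"
    and "l1 \<equiv> (1 :: real)"
    and "l2 \<equiv> (1 - \<beta> / real n) powr (\<alpha> + 1)"
  shows
    "(\<forall>k j. P \<alpha> \<beta> n k j =
        ((real n - \<beta>) / (2 * real n - \<beta>)) powr (real k + \<alpha> + 1) *
        (real n / (2 * real n - \<beta>)) ^ j * (pochhammer (real k + \<alpha> + 1) j / fact j)) \<and>
     (\<forall>k j. P \<alpha> \<beta> n k j \<ge> 0) \<and>
     (\<forall>k. (\<lambda>j. P \<alpha> \<beta> n k j) sums 1) \<and>
     (\<forall>v. (\<forall>x\<ge>0. Phi_converges n v x) \<longrightarrow> P_apply_defined \<alpha> \<beta> n v \<longrightarrow>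
        (\<forall>k. set_integrable lborel {0<..} (M_integrand \<alpha> \<beta> n (Phi n v) k)) \<and>
        (\<forall>x\<ge>0. (M_defined \<alpha> \<beta> n (Phi n v) x \<longleftrightarrow> Phi_converges n (P_apply \<alpha> \<beta> n v) x) \<and>
                M \<alpha> \<beta> n (Phi n v) x = Phi n (P_apply \<alpha> \<beta> n v) x)) \<and>
     M_eigenpair \<alpha> \<beta> n l1 \<phi>1 \<and>
     M_eigenpair \<alpha> \<beta> n l2 \<phi>2 \<and>
     P_apply_defined \<alpha> \<beta> n v1 \<and> (\<forall>k. P_apply \<alpha> \<beta> n v1 k = v1 k) \<and>
     P_apply_defined \<alpha> \<beta> n v2 \<and> (\<forall>k. P_apply \<alpha> \<beta> n v2 k = l2 * v2 k) \<and>
     (\<forall>x\<ge>0. Phi_converges n v1 x \<and> Phi n v1 x = \<phi>1 x) \<and>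
     (\<forall>x\<ge>0. Phi_converges n v2 x \<and> Phi n v2 x = \<phi>2 x)"
proof -
  note h = assms(1,2,4)
  have lift1: "(\<lambda>j. v1 j * psi n j x) sums \<phi>1 x" for x
    using psi_powers_sums[of 1 n x] by (simp add: v1_def \<phi>1_def)
  have lift2: "(\<lambda>j. v2 j * psi n j x) sums \<phi>2 x" for x
    using psi_powers_sums[of "1 - \<beta> / real n" n x] assms(3) by (simp add: v2_def \<phi>2_def)
  have Phi1: "Phi_converges n v1 x" "Phi n v1 = \<phi>1" for x
    using lift1 by (auto simp: Phi_converges_def Phi_def sums_iff)
  have Phi2: "Phi_converges n v2 x" "Phi n v2 = \<phi>2" for x
    using lift2 by (auto simp: Phi_converges_def Phi_def sums_iff)
  have eig1: "(\<lambda>j. P \<alpha> \<beta> n k j * v1 j) sums (l1 * v1 k)" for k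
    using P_row_sums[OF h] by (simp add: v1_def l1_def)
  have eig2: "(\<lambda>j. P \<alpha> \<beta> n k j * v2 j) sums (l2 * v2 k)" for k
    using P_eigenvector_sums[OF h] by (simp add: v2_def l2_def)
  \<comment> \<open>Both eigenfunctions take the value 1 at x = 0, which serves as the nonzero
    point.\<close>
  have "M_eigenpair \<alpha> \<beta> n l1 (Phi n v1)"
    by (rule M_eigenpair_Phi[OF h, where x = 0]) (use Phi1 eig1 in \<open>auto simp: \<phi>1_def\<close>)
  moreover have "M_eigenpair \<alpha> \<beta> n l2 (Phi n v2)"
    by (rule M_eigenpair_Phi[OF h, where x = 0]) (use Phi2 eig2 in \<open>auto simp: \<phi>2_def\<close>)
  moreover have "P_apply_defined \<alpha> \<beta> n v1" "P_apply \<alpha> \<beta> n v1 k = v1 k" for k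
    using eig1 by (auto simp: P_apply_defined_def P_apply_def sums_iff l1_def)
  moreover have "P_apply_defined \<alpha> \<beta> n v2" "P_apply \<alpha> \<beta> n v2 k = l2 * v2 k" for k
    using eig2 by (auto simp: P_apply_defined_def P_apply_def sums_iff)
  ultimately show ?thesis
    using P_eq[OF h] P_nonneg[OF h] P_row_sums[OF h] Phi1 Phi2
      set_integrable_M_integrand_Phi[OF h] M_Phi[OF h]
    by (intro conjI allI impI) (auto simp only:)
qed

end
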